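(* For all integers $n\geq 1$ and $k\geq 2$, $$\mathrm{NC}_{n+1}^{(k)}(t)=t\sum_{i=0}^{n}\binom{n}{i}\mathrm{NW}_{i}^{(k)}(t),$$ where $\mathrm{NW}_0^{(k)}(t)=1$ by convention.
   Context: For a set partition $P$ of $[m]=\{1,\dots,m\}$, its arc diagram has nodes $1,\dots,m$ and an arc $(i,j)$, $i<j$, whenever $i,j$ lie in the same block and that block contains no $l$ with $i<l<j$ (and a loop $(i,i)$ when $\{i\}$ is a block). A $k$-crossing of $P$ is a set of $k$ arcs $(i_1,j_1),\dots,(i_k,j_k)$ of its arc diagram with $i_1<i_2<\cdots<i_k<j_1<j_2<\cdots<j_k$; a weak $k$-crossing is a set of $k$ arcs with $i_1<i_2<\cdots<i_k=j_1<j_2<\cdots<j_k$. $k$-crossings and weak $k$-crossings are together called enhanced $k$-crossings. $P$ is $k$-noncrossing if it has no $k$-crossing, and enhanced $k$-noncrossing if it has no enhanced $k$-crossing. $\mathrm{NC}_m^{(k)}(t)$ (resp. $\mathrm{NW}_m^{(k)}(t)$) is the sum of $t^{\text{number of blocks of }P}$ over all $k$-noncrossing (resp. enhanced $k$-noncrossing) partitions $P$ of $[m]$. *)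

theory Defs
  imports "HOL-Library.Disjoint_Sets" "HOL-Computational_Algebra.Polynomial"
begin

definition arcs :: "nat set set \<Rightarrow> (nat \<times> nat) set" where
  "arcs P = {(i, j). \<exists>B\<in>P. i \<in> B \<and> j \<in> B \<and> i < j \<and> \<not> (\<exists>l\<in>B. i < l \<and> l < j)}
          \<union> {(i, i) | i. {i} \<in> P}"

definition is_crossing :: "nat \<Rightarrow> nat set set \<Rightarrow> (nat \<times> nat) set \<Rightarrow> bool" where
  "is_crossing k P C \<longleftrightarrow> C \<subseteq> arcs P \<and>
     (\<exists>i j. C = (\<lambda>r. (i r, j r)) ` {1..k} \<and>
        strict_mono_on {1..k} i \<and> i k < j 1 \<and> strict_mono_on {1..k} j)"

definition is_weak_crossing :: "nat \<Rightarrow> nat set set \<Rightarrow> (nat \<times> nat) set \<Rightarrow> bool" where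
  "is_weak_crossing k P C \<longleftrightarrow> C \<subseteq> arcs P \<and>
     (\<exists>i j. C = (\<lambda>r. (i r, j r)) ` {1..k} \<and>
        strict_mono_on {1..k} i \<and> i k = j 1 \<and> strict_mono_on {1..k} j)"

definition is_enhanced_crossing :: "nat \<Rightarrow> nat set set \<Rightarrow> (nat \<times> nat) set \<Rightarrow> bool" where
  "is_enhanced_crossing k P C \<longleftrightarrow> is_crossing k P C \<or> is_weak_crossing k P C"

definition noncrossing :: "nat \<Rightarrow> nat set set \<Rightarrow> bool" where
  "noncrossing k P \<longleftrightarrow> \<not> (\<exists>C. is_crossing k P C)"

definition enhanced_noncrossing :: "nat \<Rightarrow> nat set set \<Rightarrow> bool" where
  "enhanced_noncrossing k P \<longleftrightarrow> \<not> (\<exists>C. is_enhanced_crossing k P C)"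

definition NC :: "nat \<Rightarrow> nat \<Rightarrow> int poly" where
  "NC k m = (\<Sum>P | partition_on {1..m} P \<and> noncrossing k P. monom 1 (card P))"

definition NW :: "nat \<Rightarrow> nat \<Rightarrow> int poly" where
  "NW k m = (\<Sum>P | partition_on {1..m} P \<and> enhanced_noncrossing k P. monom 1 (card P))"

text \<open>The convention for \<open>m = 0\<close> agrees with the general definition, since the empty partition
  is the only partition of the empty set.\<close>

lemma NW_0:
  assumes "k \<ge> 1"
  shows "NW k 0 = 1"
proof -
  have "enhanced_noncrossing k {}"
    using assms
    by (auto simp: enhanced_noncrossing_def is_enhanced_crossing_def is_crossing_def
        is_weak_crossing_def arcs_def)
  then have "{P. partition_on {1..0::nat} P \<and> enhanced_noncrossing k P} = {{}}"
    by (auto simp: partition_on_empty)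
  then show ?thesis
    by (simp add: NW_def)
qed

text \<open>The sums above range over finite sets, so none is zero by default.\<close>

lemma finite_partitions: "finite {P. partition_on {1..m::nat} P \<and> Q P}"
  by (rule finite_subset[of _ "Pow (Pow {1..m})"]) (auto simp: partition_on_def)

end

theory Submission
  imports Defs "HOL-Library.Infinite_Set"
begin

text \<open>
  A partition of a finite set \<open>S\<close> is determined by its proper arcs, which may be any set of
  increasing pairs in which no two start or end at the same point; it has as many blocks as \<open>S\<close>
  has points that are not the right end of a proper arc. Moving every right end one step to the
  left turns the arcs \<open>(i, i + 1)\<close> of a partition of \<open>{1..n + 1}\<close> into points \<open>i\<close> of \<open>{1..n}\<close>
  that meet no other arc, and the remaining arcs into those of a partition of the set of the
  other points. As \<open>i\<^sub>k < j\<^sub>1\<close> becomes \<open>i\<^sub>k \<le> j\<^sub>1\<close>, crossings correspond to enhanced crossings.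
\<close>

section \<open>Proper arcs, and crossings expressed through them\<close>

definition proper_arcs :: "nat set set \<Rightarrow> nat rel" where
  "proper_arcs P = {(i, j). \<exists>B\<in>P. i \<in> B \<and> j \<in> B \<and> i < j \<and> (\<forall>l\<in>B. \<not> (i < l \<and> l < j))}"

text \<open>Encoding the arcs as a relation makes reflexive transitive closures available: paths
  along arcs recover the blocks. The two single-valuedness conditions exclude common left ends and
  common right ends.\<close>

definition arc_systems :: "nat set \<Rightarrow> nat rel set" where
  "arc_systems S =
    {A. A \<subseteq> S \<times> S \<and> (\<forall>(i, j)\<in>A. i < j) \<and> single_valued A \<and> single_valued (A\<inverse>)}"

text \<open>The parameter \<open>R\<close> treats both notions at once: \<open><\<close> gives
  crossings, while \<open>\<le>\<close> merges crossings with weak crossings.\<close>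

definition crosses :: "(nat \<Rightarrow> nat \<Rightarrow> bool) \<Rightarrow> nat \<Rightarrow> nat rel \<Rightarrow> bool" where
  "crosses R k A \<longleftrightarrow> (\<exists>i j. (\<forall>r\<in>{1..k}. (i r, j r) \<in> A) \<and>
     strict_mono_on {1..k} i \<and> R (i k) (j 1) \<and> strict_mono_on {1..k} j)"

lemma proper_arcs_altdef: "proper_arcs P = {(i, j) \<in> arcs P. i < j}"
  by (auto simp: proper_arcs_def arcs_def)

lemma proper_arcs_subset_arcs: "proper_arcs P \<subseteq> arcs P"
  by (auto simp: proper_arcs_altdef)

text \<open>No loop takes part in a crossing, because \<open>i r \<le> i k < j 1 \<le> j r\<close>.
  Restricting to proper arcs therefore loses nothing.\<close>

lemma noncrossing_iff:
  assumes "k \<ge> 1"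
  shows "noncrossing k P \<longleftrightarrow> \<not> crosses (<) k (proper_arcs P)"
proof -
  have "(\<exists>C. is_crossing k P C) \<longleftrightarrow> crosses (<) k (proper_arcs P)"
  proof
    assume "\<exists>C. is_crossing k P C"
    then obtain i j where *: "\<forall>r\<in>{1..k}. (i r, j r) \<in> arcs P" "strict_mono_on {1..k} i"
      "i k < j 1" "strict_mono_on {1..k} j"
      unfolding is_crossing_def by blast
    have "i r < j r" if "r \<in> {1..k}" for r
    proof -
      have "i r \<le> i k" "j 1 \<le> j r"
        using that * strict_mono_on_leD[of "{1..k}"] by auto
      then show ?thesis using *(3) by linarith
    qed
    then show "crosses (<) k (proper_arcs P)"
      using * unfolding crosses_def proper_arcs_altdef by blast
  next
    assume "crosses (<) k (proper_arcs P)"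
    then obtain i j where *: "\<forall>r\<in>{1..k}. (i r, j r) \<in> proper_arcs P" "strict_mono_on {1..k} i"
      "i k < j 1" "strict_mono_on {1..k} j"
      unfolding crosses_def by blast
    then have "is_crossing k P ((\<lambda>r. (i r, j r)) ` {1..k})"
      unfolding is_crossing_def using proper_arcs_subset_arcs[of P] by blast
    then show "\<exists>C. is_crossing k P C" ..
  qed
  then show ?thesis by (simp add: noncrossing_def)
qed

lemma enhanced_noncrossing_iff:
  assumes "k \<ge> 2"
  shows "enhanced_noncrossing k P \<longleftrightarrow> \<not> crosses (\<le>) k (proper_arcs P)"
proof -
  have "(\<exists>C. is_enhanced_crossing k P C) \<longleftrightarrow> crosses (\<le>) k (proper_arcs P)"
  proof
    assume "\<exists>C. is_enhanced_crossing k P C"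
    then obtain i j where "(\<lambda>r. (i r, j r)) ` {1..k} \<subseteq> arcs P"
      and "strict_mono_on {1..k} i" "i k < j 1 \<or> i k = j 1" "strict_mono_on {1..k} j"
      unfolding is_enhanced_crossing_def is_crossing_def is_weak_crossing_def by blast
    then have *: "\<forall>r\<in>{1..k}. (i r, j r) \<in> arcs P" "strict_mono_on {1..k} i"
      "i k \<le> j 1" "strict_mono_on {1..k} j"
      by auto
    \<comment> \<open>Loops are excluded because \<open>i\<^sub>1 < i\<^sub>k\<close> and \<open>j\<^sub>1 < j\<^sub>r\<close> for \<open>r > 1\<close>, which needs \<open>k \<ge> 2\<close>.\<close>
    have "i r < j r" if "r \<in> {1..k}" for r
    proof (cases "r = 1")
      case True
      then have "i r < i k" using assms strict_mono_onD[OF *(2), of 1 k] by auto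
      then show ?thesis using True *(3) by simp
    next
      case False
      then have "j 1 < j r" using that strict_mono_onD[OF *(4), of 1 r] by auto
      moreover have "i r \<le> i k" using that strict_mono_on_leD[OF *(2), of r k] by auto
      ultimately show ?thesis using *(3) by linarith
    qed
    then show "crosses (\<le>) k (proper_arcs P)"
      using * unfolding crosses_def proper_arcs_altdef by blast
  next
    assume "crosses (\<le>) k (proper_arcs P)"
    then obtain i j where *: "\<forall>r\<in>{1..k}. (i r, j r) \<in> proper_arcs P" "strict_mono_on {1..k} i"
      "i k \<le> j 1" "strict_mono_on {1..k} j"
      unfolding crosses_def by blast
    have "(\<lambda>r. (i r, j r)) ` {1..k} \<subseteq> arcs P"
      using * proper_arcs_subset_arcs[of P] by blast
    moreover have "i k < j 1 \<or> i k = j 1" using *(3) by linarith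
    ultimately have "is_enhanced_crossing k P ((\<lambda>r. (i r, j r)) ` {1..k})"
      unfolding is_enhanced_crossing_def is_crossing_def is_weak_crossing_def
      using *(2,4) by blast
    then show "\<exists>C. is_enhanced_crossing k P C" ..
  qed
  then show ?thesis by (simp add: enhanced_noncrossing_def)
qed

section \<open>Set partitions correspond to arc systems\<close>

lemma partition_on_block_unique:
  assumes "partition_on S P" "B \<in> P" "C \<in> P" "x \<in> B" "x \<in> C"
  shows "B = C"
  using assms by (metis disjnt_iff pairwiseD partition_onD2)

text \<open>Two arcs with a common left or right end lie in the same block. If they differed, the
  other end of the shorter one would lie strictly inside the longer one.\<close>

lemma proper_arcs_in_arc_systems:
  assumes P: "partition_on S P"
  shows "proper_arcs P \<in> arc_systems S"
proof -
  have "proper_arcs P \<subseteq> S \<times> S"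
    using partition_onD1[OF P] by (auto simp: proper_arcs_def)
  moreover have "single_valued (proper_arcs P)"
  proof (rule single_valuedI)
    fix x y z assume "(x, y) \<in> proper_arcs P" "(x, z) \<in> proper_arcs P"
    then show "y = z"
      unfolding proper_arcs_def
      by clarsimp (metis P linorder_cases partition_on_block_unique)
  qed
  moreover have "single_valued ((proper_arcs P)\<inverse>)"
  proof (rule single_valuedI)
    fix x y z assume "(x, y) \<in> (proper_arcs P)\<inverse>" "(x, z) \<in> (proper_arcs P)\<inverse>"
    then show "y = z"
      unfolding proper_arcs_def
      by clarsimp (metis P linorder_cases partition_on_block_unique)
  qed
  ultimately show ?thesis by (auto simp: arc_systems_def proper_arcs_def)
qed

lemma rtrancl_proper_arcs_same_block:
  assumes P: "partition_on S P" and "B \<in> P" "x \<in> B" "(x, y) \<in> (proper_arcs P)\<^sup>*"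
  shows "y \<in> B"
  using assms(4)
proof induction
  case base
  then show ?case using assms by simp
next
  case (step y z)
  then show ?case
    using partition_on_block_unique[OF P _ \<open>B \<in> P\<close>] by (auto simp: proper_arcs_def)
qed

text \<open>The path walks through the elements of \<open>B\<close> from \<open>x\<close> to
  \<open>y\<close> in increasing order; the induction is on the remaining distance.\<close>

lemma same_block_rtrancl_proper_arcs:
  assumes "finite B" "B \<in> P" "x \<in> B" "y \<in> B" "x \<le> y"
  shows "(x, y) \<in> (proper_arcs P)\<^sup>*"
  using assms(3,5)
proof (induction "y - x" arbitrary: x rule: less_induct)
  case less
  show ?case
  proof (cases "x = y")
    case False
    \<comment> \<open>\<open>Min M\<close> will be the successor of \<open>x\<close> within
      \<open>B\<close>, so that \<open>(x, Min M)\<close> is an arc.\<close>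
    define M where "M = {l \<in> B. x < l}"
    have M: "finite M" "y \<in> M"
      using assms less.prems False by (auto simp: M_def)
    then have z: "Min M \<in> M" "Min M \<le> y" by (auto intro: Min_in)
    have "Min M \<le> l" if "l \<in> B" "x < l" for l
      using that M(1) by (intro Min_le) (auto simp: M_def)
    then have "\<forall>l\<in>B. \<not> (x < l \<and> l < Min M)"
      using leD by blast
    then have "(x, Min M) \<in> proper_arcs P"
      unfolding proper_arcs_def using z(1) assms(2) less.prems by (auto simp: M_def)
    moreover have "(Min M, y) \<in> (proper_arcs P)\<^sup>*"
      using z less.prems False by (intro less.hyps) (auto simp: M_def)
    ultimately show ?thesis by (rule converse_rtrancl_into_rtrancl)
  qed simp
qed

text \<open>The equivalence relation whose classes are the blocks. Paths do not branch, so two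
  points of a block are joined by a path in one of the two directions. The bound
  \<open>S \<times> S\<close> is there because \<open>A\<^sup>*\<close> is reflexive on all natural
  numbers.\<close>

definition linked :: "nat set \<Rightarrow> nat rel \<Rightarrow> nat rel" where
  "linked S A = {(x, y) \<in> S \<times> S. (x, y) \<in> A\<^sup>* \<or> (y, x) \<in> A\<^sup>*}"

text \<open>One half of the bijection: a partition can be recovered from its proper arcs.\<close>

lemma quotient_linked_proper_arcs:
  assumes P: "partition_on S P" and "finite S"
  shows "S // linked S (proper_arcs P) = P"
proof -
  have "linked S (proper_arcs P) = {(x, y). \<exists>B\<in>P. x \<in> B \<and> y \<in> B}"
  proof (intro equalityI subrelI)
    fix x y assume "(x, y) \<in> linked S (proper_arcs P)"
    then have "x \<in> S" "y \<in> S" "(x, y) \<in> (proper_arcs P)\<^sup>* \<or> (y, x) \<in> (proper_arcs P)\<^sup>*"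
      by (auto simp: linked_def)
    then show "(x, y) \<in> {(x, y). \<exists>B\<in>P. x \<in> B \<and> y \<in> B}"
      using rtrancl_proper_arcs_same_block[OF P] partition_onD1[OF P] by blast
  next
    fix x y assume "(x, y) \<in> {(x, y). \<exists>B\<in>P. x \<in> B \<and> y \<in> B}"
    then obtain B where B: "B \<in> P" "x \<in> B" "y \<in> B" by blast
    then have "B \<subseteq> S" using partition_onD1[OF P] by blast
    then have "finite B" using \<open>finite S\<close> finite_subset by blast
    then show "(x, y) \<in> linked S (proper_arcs P)"
      using B same_block_rtrancl_proper_arcs[of B P] \<open>B \<subseteq> S\<close> nat_le_linear[of x y]
      by (auto simp: linked_def)
  qed
  then show ?thesis using partition_on_eq_quotient[OF P] by simp
qed

lemma arc_systems_rtrancl_le: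
  assumes "A \<in> arc_systems S" "(x, y) \<in> A\<^sup>*"
  shows "x \<le> y"
  using assms(2)
proof induction
  case (step y z)
  then show ?case using assms(1) by (fastforce simp: arc_systems_def)
qed simp

lemma equiv_linked:
  assumes A: "A \<in> arc_systems S"
  shows "equiv S (linked S A)"
proof (rule equivI)
  have sv: "single_valued A" "single_valued (A\<inverse>)" using A by (auto simp: arc_systems_def)
  show "trans (linked S A)"
  proof (rule transI)
    fix x y z assume "(x, y) \<in> linked S A" "(y, z) \<in> linked S A"
    then have "x \<in> S" "z \<in> S"
      and "(x, y) \<in> A\<^sup>* \<or> (y, x) \<in> A\<^sup>*" "(y, z) \<in> A\<^sup>* \<or> (z, y) \<in> A\<^sup>*"
      by (auto simp: linked_def)
    \<comment> \<open>The critical cases are two paths leaving \<open>y\<close> and two paths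
      entering \<open>y\<close>. By single-valuedness of \<open>A\<close> or of its converse, one of
      the two paths continues the other.\<close>
    then show "(x, z) \<in> linked S A"
      using single_valued_confluent[OF sv(1), of y x z]
        single_valued_confluent[OF sv(2), of y x z]
      by (auto simp: linked_def rtrancl_converse intro: rtrancl_trans)
  qed
qed (auto simp: linked_def refl_on_def sym_def)

text \<open>The other half of the bijection: every arc system is the set of proper arcs of some
  partition.\<close>

lemma proper_arcs_quotient_linked:
  assumes A: "A \<in> arc_systems S"
  shows "proper_arcs (S // linked S A) = A"
proof -
  note eq = equiv_linked[OF A]
  have sv: "single_valued A" and AS: "A \<subseteq> S \<times> S"
    and less: "\<And>i j. (i, j) \<in> A \<Longrightarrow> i < j"
    using A by (auto simp: arc_systems_def)
  have arc_iff: "(i, j) \<in> proper_arcs (S // linked S A) \<longleftrightarrow>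
      (i, j) \<in> linked S A \<and> i < j \<and> (\<forall>l. (i, l) \<in> linked S A \<longrightarrow> \<not> (i < l \<and> l < j))"
    (is "?lhs \<longleftrightarrow> ?rhs") for i j
  proof
    assume ?lhs
    then obtain B where B: "B \<in> S // linked S A" "i \<in> B" "j \<in> B" "i < j"
      "\<forall>l\<in>B. \<not> (i < l \<and> l < j)"
      by (auto simp: proper_arcs_def)
    then show ?rhs
      using quotient_eq_iff[OF eq B(1) B(1) B(2)] eq
      by (metis in_quotient_imp_closed)
  next
    assume ?rhs
    moreover from this have "i \<in> S" by (auto simp: linked_def)
    moreover from this have "linked S A `` {i} \<in> S // linked S A" by (rule quotientI)
    moreover have "i \<in> linked S A `` {i}" using \<open>i \<in> S\<close> by (auto simp: linked_def)
    ultimately show ?lhs unfolding proper_arcs_def by blast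
  qed
  show ?thesis
  proof (intro equalityI subrelI)
    fix i j assume "(i, j) \<in> proper_arcs (S // linked S A)"
    then have *: "(i, j) \<in> linked S A" "i < j"
      "\<And>l. (i, l) \<in> linked S A \<Longrightarrow> \<not> (i < l \<and> l < j)"
      using arc_iff by blast+
    then have "(i, j) \<in> A\<^sup>*" "i \<in> S"
      using arc_systems_rtrancl_le[OF A] by (fastforce simp: linked_def)+
    \<comment> \<open>Let \<open>z\<close> be the first point after \<open>i\<close> on the path to
      \<open>j\<close>. It is linked to \<open>i\<close> and at most \<open>j\<close>, and no linked
      point lies strictly between, so \<open>z = j\<close>.\<close>
    from this(1) \<open>i < j\<close> obtain z where z: "(i, z) \<in> A" "(z, j) \<in> A\<^sup>*"
      by (cases rule: converse_rtranclE) auto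
    then have "(i, z) \<in> linked S A" using AS by (auto simp: linked_def)
    then have "z = j"
      using *(3) less[OF z(1)] arc_systems_rtrancl_le[OF A z(2)] by fastforce
    then show "(i, j) \<in> A" using z by simp
  next
    fix i j assume ij: "(i, j) \<in> A"
    have "\<not> (i < l \<and> l < j)" if "(i, l) \<in> linked S A" for l
    proof
      assume l: "i < l \<and> l < j"
      then have "(i, l) \<in> A\<^sup>*"
        using that arc_systems_rtrancl_le[OF A] by (fastforce simp: linked_def)
      \<comment> \<open>The path to \<open>l\<close> must begin with the only arc leaving
        \<open>i\<close>, which is \<open>(i, j)\<close>; hence \<open>j \<le> l\<close>.\<close>
      then obtain z where z: "(i, z) \<in> A" "(z, l) \<in> A\<^sup>*"
        using l by (cases rule: converse_rtranclE) auto
      then have "z = j" using ij sv by (auto dest: single_valuedD)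
      then show False using arc_systems_rtrancl_le[OF A z(2)] l by simp
    qed
    then show "(i, j) \<in> proper_arcs (S // linked S A)"
      using ij less AS unfolding arc_iff by (auto simp: linked_def)
  qed
qed

section \<open>Number of blocks and the generating polynomials\<close>

lemma finite_arc_systems:
  assumes "finite S"
  shows "finite (arc_systems S)"
  by (rule finite_subset[of _ "Pow (S \<times> S)"]) (use assms in \<open>auto simp: arc_systems_def\<close>)

lemma finite_arc_system:
  assumes "A \<in> arc_systems S" "finite S"
  shows "finite A"
  using assms by (auto simp: arc_systems_def intro: finite_subset[of _ "S \<times> S"])

lemma card_Range_arc_system:
  assumes "A \<in> arc_systems S"
  shows "card (Range A) = card A"
proof -
  have "inj_on snd A"
    using assms by (auto simp: arc_systems_def inj_on_def single_valued_def)
  then show ?thesis by (metis Range_snd card_image)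
qed

text \<open>This bound keeps the natural-number subtraction \<open>card S - card A\<close> from
  truncating.\<close>

lemma card_arc_system_le:
  assumes "A \<in> arc_systems S" "finite S"
  shows "card A \<le> card S"
proof -
  have "Range A \<subseteq> S" using assms by (auto simp: arc_systems_def)
  then show ?thesis using card_mono[OF assms(2)] card_Range_arc_system[OF assms(1)] by metis
qed

text \<open>Each block has exactly one point that is not the right end of a proper arc, namely its
  minimum. The right ends themselves are as many as the arcs.\<close>

lemma card_partition_proper_arcs:
  assumes P: "partition_on S P" and "finite S"
  shows "card P = card S - card (proper_arcs P)"
proof -
  have block: "finite B" "B \<noteq> {}" "B \<subseteq> S" if "B \<in> P" for B
    using that partition_onD1[OF P] partition_onD3[OF P] \<open>finite S\<close>
    by (auto intro: finite_subset)
  have "bij_betw Min P (S - Range (proper_arcs P))"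
  proof (rule bij_betw_imageI)
    show "inj_on Min P"
      by (rule inj_onI) (metis Min_in P block(1,2) partition_on_block_unique)
    show "Min ` P = S - Range (proper_arcs P)"
    proof (intro equalityI subsetI)
      fix x assume "x \<in> Min ` P"
      then obtain B where B: "B \<in> P" "x = Min B" by blast
      then have x: "x \<in> B" using block Min_in by blast
      have "x \<notin> Range (proper_arcs P)"
      proof
        assume "x \<in> Range (proper_arcs P)"
        then obtain i C where "C \<in> P" "x \<in> C" "i \<in> C" "i < x"
          by (auto simp: proper_arcs_def)
        then show False
          using B x partition_on_block_unique[OF P] block(1) Min_le leD by metis
      qed
      then show "x \<in> S - Range (proper_arcs P)" using x B block by blast
    next
      fix x assume x: "x \<in> S - Range (proper_arcs P)"
      then obtain B where B: "B \<in> P" "x \<in> B" using partition_onD1[OF P] by blast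
      have "(Min B, x) \<in> (proper_arcs P)\<^sup>*"
        using B block by (intro same_block_rtrancl_proper_arcs) auto
      \<comment> \<open>A nonempty path to \<open>x\<close> would finish with an arc whose right end
        is \<open>x\<close>.\<close>
      then have "Min B = x" using x by (auto elim: rtranclE)
      then show "x \<in> Min ` P" using B by blast
    qed
  qed
  then have "card P = card (S - Range (proper_arcs P))" by (rule bij_betw_same_card)
  also have "Range (proper_arcs P) \<subseteq> S"
    using partition_onD1[OF P] by (auto simp: proper_arcs_def)
  then have "card (S - Range (proper_arcs P)) = card S - card (Range (proper_arcs P))"
    using \<open>finite S\<close> by (intro card_Diff_subset) (auto intro: finite_subset)
  finally show ?thesis
    using card_Range_arc_system[OF proper_arcs_in_arc_systems[OF P]] by simp
qed

text \<open>The exponent is the number of blocks of the corresponding partition. A general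
  \<open>S\<close> is allowed because the recursion runs over subsets of
  \<open>{1..n}\<close>.\<close>

definition arc_sum :: "(nat \<Rightarrow> nat \<Rightarrow> bool) \<Rightarrow> nat \<Rightarrow> nat set \<Rightarrow> int poly" where
  "arc_sum R k S = (\<Sum>A | A \<in> arc_systems S \<and> \<not> crosses R k A. monom 1 (card S - card A))"

text \<open>The bijection between partitions and arc systems transports any property
  \<open>N\<close> that is expressed through proper arcs, so it serves both noncrossing
  notions.\<close>

lemma partition_sum_eq_arc_sum:
  assumes "finite S" and "\<And>P. N P \<longleftrightarrow> \<not> crosses R k (proper_arcs P)"
  shows "(\<Sum>P | partition_on S P \<and> N P. monom 1 (card P)) = arc_sum R k S"
  unfolding arc_sum_def
  by (rule sum.reindex_bij_witness[of _ "\<lambda>A. S // linked S A" proper_arcs])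
    (auto simp: assms quotient_linked_proper_arcs proper_arcs_quotient_linked
      proper_arcs_in_arc_systems card_partition_proper_arcs
      intro: partition_on_quotient equiv_linked)

lemma NC_eq_arc_sum: "k \<ge> 1 \<Longrightarrow> NC k m = arc_sum (<) k {1..m}"
  unfolding NC_def by (rule partition_sum_eq_arc_sum) (simp_all add: noncrossing_iff)

lemma NW_eq_arc_sum: "k \<ge> 2 \<Longrightarrow> NW k m = arc_sum (\<le>) k {1..m}"
  unfolding NW_def by (rule partition_sum_eq_arc_sum) (simp_all add: enhanced_noncrossing_iff)

section \<open>Invariance under increasing relabelling\<close>

lemma arc_systems_map:
  assumes A: "A \<in> arc_systems T" and h: "strict_mono_on T h"
  shows "map_prod h h ` A \<in> arc_systems (h ` T)"
proof -
  have inj: "h x = h y \<longleftrightarrow> x = y" if "x \<in> T" "y \<in> T" for x y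
    using that strict_mono_on_imp_inj_on[OF h] by (auto simp: inj_on_eq_iff)
  have AT: "x \<in> T" "y \<in> T" if "(x, y) \<in> A" for x y
    using that A by (auto simp: arc_systems_def)
  have "single_valued (map_prod h h ` A)" "single_valued ((map_prod h h ` A)\<inverse>)"
    using A AT by (auto simp: arc_systems_def single_valued_def inj)
  moreover have "\<forall>(i, j)\<in>map_prod h h ` A. i < j"
    using A AT h by (fastforce simp: arc_systems_def dest: strict_mono_onD)
  ultimately show ?thesis
    using AT by (auto simp: arc_systems_def)
qed

lemma crosses_map:
  assumes A: "A \<in> arc_systems T" and h: "strict_mono_on T h" and "k \<ge> 1"
    and "crosses (\<le>) k A"
  shows "crosses (\<le>) k (map_prod h h ` A)"
proof -
  obtain i j where *: "\<forall>r\<in>{1..k}. (i r, j r) \<in> A" "strict_mono_on {1..k} i"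
    "i k \<le> j 1" "strict_mono_on {1..k} j"
    using assms(4) unfolding crosses_def by blast
  have T: "i r \<in> T" "j r \<in> T" if "r \<in> {1..k}" for r
    using that *(1) A by (auto simp: arc_systems_def)
  have "strict_mono_on {1..k} (h \<circ> i)" "strict_mono_on {1..k} (h \<circ> j)"
    using T by (auto intro!: strict_mono_onI strict_mono_onD[OF h]
        strict_mono_onD[OF *(2)] strict_mono_onD[OF *(4)])
  moreover have "(h \<circ> i) k \<le> (h \<circ> j) 1"
    using * T \<open>k \<ge> 1\<close> by (auto intro!: strict_mono_on_leD[OF h])
  moreover have "\<forall>r\<in>{1..k}. ((h \<circ> i) r, (h \<circ> j) r) \<in> map_prod h h ` A"
    using *(1) by force
  ultimately show ?thesis unfolding crosses_def by blast
qed

text \<open>The inverse \<open>g\<close> of \<open>h\<close> is increasing too, so both maps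
  preserve arc systems and crossings and they induce mutually inverse bijections.\<close>

lemma arc_sum_image:
  assumes h: "strict_mono_on T h" and "finite T" "k \<ge> 1"
  shows "arc_sum (\<le>) k (h ` T) = arc_sum (\<le>) k T"
proof -
  define g where "g = inv_into T h"
  have inj: "inj_on h T" using h by (rule strict_mono_on_imp_inj_on)
  have gh: "g (h x) = x" if "x \<in> T" for x using that inj by (simp add: g_def)
  have g: "strict_mono_on (h ` T) g"
    using h inj by (auto intro!: strict_mono_onI simp: gh strict_mono_on_less)
  have gT: "g ` h ` T = T" using gh by force
  have left_inv: "map_prod g g ` map_prod h h ` A = A" if "A \<in> arc_systems T" for A
  proof -
    have "(map_prod g g \<circ> map_prod h h) x = x" if "x \<in> A" for x
      using that \<open>A \<in> arc_systems T\<close> gh by (auto simp: arc_systems_def)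
    then show ?thesis by (force simp: image_comp)
  qed
  have right_inv: "map_prod h h ` map_prod g g ` A = A" if "A \<in> arc_systems (h ` T)" for A
  proof -
    have "(map_prod h h \<circ> map_prod g g) x = x" if "x \<in> A" for x
      using that \<open>A \<in> arc_systems (h ` T)\<close> gh by (fastforce simp: arc_systems_def)
    then show ?thesis by (force simp: image_comp)
  qed
  have card_map: "card (map_prod g g ` A) = card A" if "A \<in> arc_systems (h ` T)" for A
  proof -
    have "finite A" using finite_arc_system[OF that] \<open>finite T\<close> by simp
    then show ?thesis
      \<comment> \<open>Taking images under \<open>g\<close> and then under \<open>h\<close> returns
        \<open>A\<close>, and neither image can enlarge a finite set.\<close>
      using right_inv[OF that] card_image_le[of A "map_prod g g"]
        card_image_le[of "map_prod g g ` A" "map_prod h h"] by simp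
  qed
  have cross_iff: "crosses (\<le>) k (map_prod h h ` A) \<longleftrightarrow> crosses (\<le>) k A"
    if "A \<in> arc_systems T" for A
    using crosses_map[OF that h \<open>k \<ge> 1\<close>] crosses_map[OF arc_systems_map[OF that h] g \<open>k \<ge> 1\<close>]
      left_inv[OF that] by metis
  have mem: "map_prod g g ` A \<in> arc_systems T" if "A \<in> arc_systems (h ` T)" for A
    using arc_systems_map[OF that g] gT by simp
  show ?thesis
    unfolding arc_sum_def
  proof (rule sum.reindex_bij_witness[of _ "\<lambda>A. map_prod h h ` A" "\<lambda>A. map_prod g g ` A"])
    fix A assume "A \<in> {A \<in> arc_systems (h ` T). \<not> crosses (\<le>) k A}"
    then show "map_prod g g ` A \<in> {A \<in> arc_systems T. \<not> crosses (\<le>) k A}"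
      using mem[of A] cross_iff[OF mem, of A] right_inv[of A] by auto
  qed (use left_inv right_inv card_map cross_iff arc_systems_map[OF _ h] card_image[OF inj] in auto)
qed

lemma NW_eq_arc_sum_card:
  assumes "k \<ge> 2" "finite S"
  shows "NW k (card S) = arc_sum (\<le>) k S"
proof -
  have "arc_sum (\<le>) k M = arc_sum (\<le>) k {..<card M}" if M: "finite M" for M
  proof -
    obtain h where "bij_betw h {..<card M} M" "strict_mono_on {..<card M} h"
      using ex_bij_betw_strict_mono_card[OF M] by blast
    then show ?thesis
      using arc_sum_image[of "{..<card M}" h k] \<open>k \<ge> 2\<close> by (simp add: bij_betw_imp_surj_on)
  qed
  \<comment> \<open>Both \<open>S\<close> and \<open>{1..card S}\<close> are compared with the
    common model \<open>{..<card S}\<close>.\<close>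
  from this[of S] this[of "{1..card S}"] show ?thesis
    using assms by (simp add: NW_eq_arc_sum)
qed

text \<open>Grouping the subsets by their size produces the binomial coefficients.\<close>

lemma sum_Pow_card:
  fixes g :: "nat \<Rightarrow> 'a::comm_semiring_1"
  assumes "finite S"
  shows "(\<Sum>T\<in>Pow S. g (card T)) = (\<Sum>i=0..card S. of_nat (card S choose i) * g i)"
proof -
  have "(\<Sum>T\<in>Pow S. g (card T)) = (\<Sum>i=0..card S. \<Sum>T | T \<in> Pow S \<and> card T = i. g (card T))"
    using assms by (intro sum.group[symmetric]) (auto intro: card_mono)
  also have "\<dots> = (\<Sum>i=0..card S. of_nat (card S choose i) * g i)"
    using n_subsets[OF assms] by (intro sum.cong) auto
  finally show ?thesis .
qed

section \<open>Shifting right ends by one\<close>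

definition raise :: "nat \<Rightarrow> nat set \<Rightarrow> nat rel \<Rightarrow> nat rel" where
  "raise n S A = apsnd Suc ` (A \<union> Id_on ({1..n} - S))"

text \<open>Recovers \<open>S\<close> from \<open>raise n S A\<close>: exactly the points outside
  \<open>S\<close> receive an arc to their successor.\<close>

definition unlinked :: "nat \<Rightarrow> nat rel \<Rightarrow> nat set" where
  "unlinked n B = {i \<in> {1..n}. (i, Suc i) \<notin> B}"

text \<open>Undoes the shift; the condition \<open>i < j\<close> discards the arcs
  \<open>(i, Suc i)\<close>, which would become loops.\<close>

definition lower :: "nat rel \<Rightarrow> nat rel" where
  "lower B = {(i, j). (i, Suc j) \<in> B \<and> i < j}"

lemma in_raise_iff:
  "(i, j) \<in> raise n S A \<longleftrightarrow> (\<exists>l. j = Suc l \<and> ((i, l) \<in> A \<or> i = l \<and> i \<in> {1..n} - S))"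
  by (force simp: raise_def image_iff)

text \<open>The added arcs \<open>(i, Suc i)\<close> start at points outside \<open>S\<close>,
  whereas \<open>A\<close> only touches points of \<open>S\<close>. Hence no added arc shares a left
  end, or after the shift a right end, with an arc coming from \<open>A\<close>.\<close>

lemma raise_in_arc_systems:
  assumes "S \<subseteq> {1..n}" "A \<in> arc_systems S"
  shows "raise n S A \<in> arc_systems {1..n + 1}"
proof -
  have A: "A \<subseteq> S \<times> S" "\<forall>(i, j)\<in>A. i < j" "single_valued A" "single_valued (A\<inverse>)"
    using assms(2) by (auto simp: arc_systems_def)
  have "raise n S A \<subseteq> {1..n + 1} \<times> {1..n + 1}"
    using A(1) assms(1) by (fastforce simp: in_raise_iff)
  moreover have "\<forall>(i, j)\<in>raise n S A. i < j"
    using A(2) by (fastforce simp: in_raise_iff)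
  moreover have "single_valued (raise n S A)" "single_valued ((raise n S A)\<inverse>)"
    using A(1,3,4) by (auto simp: single_valued_def in_raise_iff)
  ultimately show ?thesis by (simp add: arc_systems_def)
qed

lemma card_raise:
  assumes "S \<subseteq> {1..n}" "A \<in> arc_systems S"
  shows "card (raise n S A) = card A + (n - card S)"
proof -
  have fin: "finite S" using assms(1) finite_subset by blast
  have "card (raise n S A) = card (A \<union> Id_on ({1..n} - S))"
    unfolding raise_def by (intro card_image) (auto simp: inj_on_def)
  also have "\<dots> = card A + card (Id_on ({1..n} - S))"
    using assms finite_arc_system[OF assms(2) fin]
    by (intro card_Un_disjoint) (auto simp: arc_systems_def Id_on_def)
  also have "card (Id_on ({1..n} - S)) = card ({1..n} - S)"
    by (rule bij_betw_same_card[of fst]) (force simp: bij_betw_def inj_on_def Id_on_def)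
  also have "\<dots> = n - card S" using assms(1) fin by (simp add: card_Diff_subset)
  finally show ?thesis .
qed

lemma lower_raise:
  assumes "A \<in> arc_systems S"
  shows "lower (raise n S A) = A"
  using assms by (auto simp: lower_def in_raise_iff arc_systems_def)

lemma unlinked_raise:
  assumes "S \<subseteq> {1..n}" "A \<in> arc_systems S"
  shows "unlinked n (raise n S A) = S"
  using assms by (auto simp: unlinked_def in_raise_iff arc_systems_def)

text \<open>An arc of \<open>B\<close> either joins neighbours, and is then restored by the
  complement of \<open>unlinked n B\<close>, or is longer and survives in
  \<open>lower B\<close>.\<close>

lemma raise_lower:
  assumes "B \<in> arc_systems {1..n + 1}"
  shows "raise n (unlinked n B) (lower B) = B"
proof (intro equalityI subrelI)
  fix i j assume "(i, j) \<in> B"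
  moreover from this have "i < j" "i \<in> {1..n}" using assms by (fastforce simp: arc_systems_def)+
  moreover obtain l where "j = Suc l" "i = l \<or> i < l"
    using \<open>i < j\<close> by (metis less_Suc_eq lessE)
  ultimately show "(i, j) \<in> raise n (unlinked n B) (lower B)"
    by (auto simp: in_raise_iff unlinked_def lower_def)
qed (auto simp: in_raise_iff unlinked_def lower_def)

lemma lower_in_arc_systems:
  assumes "B \<in> arc_systems {1..n + 1}"
  shows "lower B \<in> arc_systems (unlinked n B)"
proof -
  have B: "B \<subseteq> {1..n + 1} \<times> {1..n + 1}" "single_valued B" "single_valued (B\<inverse>)"
    using assms by (auto simp: arc_systems_def)
  have "i \<in> unlinked n B" "j \<in> unlinked n B" if "(i, Suc j) \<in> B" "i < j" for i j
  proof -
    \<comment> \<open>The longer arc \<open>(i, Suc j)\<close> already occupies the left end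
      \<open>i\<close> and the right end \<open>Suc j\<close>.\<close>
    have "(i, Suc i) \<notin> B" "(j, Suc j) \<notin> B"
      using that single_valuedD[OF B(2), of i "Suc j" "Suc i"]
        single_valuedD[OF B(3), of "Suc j" i j] by auto
    moreover have "i \<in> {1..n}" "j \<in> {1..n}" using that B(1) by auto
    ultimately show "i \<in> unlinked n B" "j \<in> unlinked n B" by (auto simp: unlinked_def)
  qed
  moreover have "single_valued (lower B)" "single_valued ((lower B)\<inverse>)"
    using B(2,3) by (auto simp: lower_def intro!: single_valuedI dest: single_valuedD)
  ultimately show ?thesis by (auto simp: arc_systems_def lower_def)
qed

lemma crosses_raise_iff:
  assumes "S \<subseteq> {1..n}" "A \<in> arc_systems S" "k \<ge> 2"
  shows "crosses (<) k (raise n S A) \<longleftrightarrow> crosses (\<le>) k A"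
proof
  assume "crosses (<) k (raise n S A)"
  then obtain i j where *: "\<forall>r\<in>{1..k}. (i r, j r) \<in> raise n S A" "strict_mono_on {1..k} i"
    "i k < j 1" "strict_mono_on {1..k} j"
    unfolding crosses_def by blast
  \<comment> \<open>Positivity makes \<open>j r - 1\<close> a true predecessor, so the shifted right
    ends stay strictly increasing.\<close>
  have "j r > 0" if "r \<in> {1..k}" for r
    using bspec[OF *(1) that] by (auto simp: in_raise_iff)
  \<comment> \<open>An arc \<open>(i, i + 1)\<close> is too short to cross another one.\<close>
  moreover have "Suc (i r) < j r" if "r \<in> {1..k}" for r
  proof (cases "r = 1")
    case True
    then have "i r < i k" using assms strict_mono_onD[OF *(2), of 1 k] by auto
    then show ?thesis using True *(3) by simp
  next
    case False
    then have "j 1 < j r" using that strict_mono_onD[OF *(4), of 1 r] by auto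
    moreover have "i r \<le> i k" using that strict_mono_on_leD[OF *(2), of r k] by auto
    ultimately show ?thesis using *(3) by linarith
  qed
  ultimately have "\<forall>r\<in>{1..k}. (i r, j r - 1) \<in> A"
    using *(1) by (fastforce simp: in_raise_iff)
  moreover have "strict_mono_on {1..k} (\<lambda>r. j r - 1)"
    using \<open>\<And>r. r \<in> {1..k} \<Longrightarrow> j r > 0\<close> *(4)
    by (intro strict_mono_onI) (auto intro!: diff_less_mono strict_mono_onD[OF *(4)] simp: Suc_le_eq)
  ultimately show "crosses (\<le>) k A"
    unfolding crosses_def using *(2,3)
    by (intro exI[of _ i] exI[of _ "\<lambda>r. j r - 1"]) auto
next
  assume "crosses (\<le>) k A"
  then obtain i j where *: "\<forall>r\<in>{1..k}. (i r, j r) \<in> A" "strict_mono_on {1..k} i"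
    "i k \<le> j 1" "strict_mono_on {1..k} j"
    unfolding crosses_def by blast
  have "strict_mono_on {1..k} (\<lambda>r. Suc (j r))"
    using *(4) by (auto simp: strict_mono_on_def)
  then show "crosses (<) k (raise n S A)"
    unfolding crosses_def using *
    by (intro exI[of _ i] exI[of _ "\<lambda>r. Suc (j r)"]) (auto simp: in_raise_iff)
qed

section \<open>The identity between the polynomials\<close>

lemma arc_sum_raise:
  assumes "k \<ge> 2"
  shows "arc_sum (<) k {1..n + 1} = monom 1 1 * (\<Sum>S\<in>Pow {1..n}. arc_sum (\<le>) k S)"
proof -
  let ?E = "\<lambda>S. {A \<in> arc_systems S. \<not> crosses (\<le>) k A}"
  have fin: "finite S" if "S \<subseteq> {1..n}" for S using that finite_subset by blast
  have "monom 1 1 * (\<Sum>S\<in>Pow {1..n}. arc_sum (\<le>) k S) =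
      (\<Sum>S\<in>Pow {1..n}. \<Sum>A\<in>?E S. monom 1 (Suc (card S - card A)))"
    by (simp add: arc_sum_def sum_distrib_left mult_monom)
  also have "\<dots> = (\<Sum>(S, A)\<in>Sigma (Pow {1..n}) ?E. monom 1 (Suc (card S - card A)))"
    using finite_arc_systems fin by (intro sum.Sigma) auto
  also have "\<dots> = arc_sum (<) k {1..n + 1}"
    unfolding arc_sum_def
  \<comment> \<open>Each arc system on \<open>{1..n + 1}\<close> comes from exactly one pair
    \<open>(S, A)\<close>: its unlinked points and its lowered arcs.\<close>
  proof (rule sum.reindex_bij_witness[of _ "\<lambda>B. (unlinked n B, lower B)" "\<lambda>(S, A). raise n S A"])
    fix p assume "p \<in> Sigma (Pow {1..n}) ?E"
    then obtain S A where p: "p = (S, A)" "S \<subseteq> {1..n}" "A \<in> arc_systems S" "\<not> crosses (\<le>) k A"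
      by auto
    show "(unlinked n (case p of (S, A) \<Rightarrow> raise n S A),
        lower (case p of (S, A) \<Rightarrow> raise n S A)) = p"
      using p by (simp add: unlinked_raise lower_raise)
    show "(case p of (S, A) \<Rightarrow> raise n S A) \<in>
        {B \<in> arc_systems {1..n + 1}. \<not> crosses (<) k B}"
      using p assms raise_in_arc_systems[of S n A] by (simp add: crosses_raise_iff)
    have "card S \<le> n" using p(2) card_mono[of "{1..n}" S] by simp
    \<comment> \<open>The \<open>n - card S\<close> added arcs cancel the points outside
      \<open>S\<close>. The point \<open>n + 1\<close> accounts for the extra one, that is, for the
      factor \<open>monom 1 1\<close>.\<close>
    then have "n + 1 - card (raise n S A) = Suc (card S - card A)"
      using card_raise[OF p(2,3)] card_arc_system_le[OF p(3) fin[OF p(2)]] by simp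
    then show "monom 1 (card {1..n + 1} - card (case p of (S, A) \<Rightarrow> raise n S A)) =
        (case p of (S, A) \<Rightarrow> monom (1 :: int) (Suc (card S - card A)))"
      using p by simp
  next
    fix B assume "B \<in> {B \<in> arc_systems {1..n + 1}. \<not> crosses (<) k B}"
    then have B: "B \<in> arc_systems {1..n + 1}" "\<not> crosses (<) k B" by auto
    show "(case (unlinked n B, lower B) of (S, A) \<Rightarrow> raise n S A) = B"
      using raise_lower[OF B(1)] by simp
    have sub: "unlinked n B \<subseteq> {1..n}" by (auto simp: unlinked_def)
    then show "(unlinked n B, lower B) \<in> Sigma (Pow {1..n}) ?E"
      using crosses_raise_iff[OF sub lower_in_arc_systems[OF B(1)] assms]
        raise_lower[OF B(1)] lower_in_arc_systems[OF B(1)] B(2) by auto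
  qed
  finally show ?thesis by simp
qed

theorem theorem1p1:
  fixes n k :: nat
  assumes "n \<ge> 1" and "k \<ge> 2"
  shows "NC k (n + 1) = monom 1 1 * (\<Sum>i=0..n. of_nat (n choose i) * NW k i)"
proof -
  have "NC k (n + 1) = monom 1 1 * (\<Sum>S\<in>Pow {1..n}. arc_sum (\<le>) k S)"
    using assms(2) arc_sum_raise[of k n] by (simp add: NC_eq_arc_sum)
  also have "(\<Sum>S\<in>Pow {1..n}. arc_sum (\<le>) k S) = (\<Sum>S\<in>Pow {1..n}. NW k (card S))"
    using assms(2) by (intro sum.cong) (auto simp: NW_eq_arc_sum_card finite_subset)
  also have "\<dots> = (\<Sum>i=0..n. of_nat (n choose i) * NW k i)"
    using sum_Pow_card[of "{1..n}" "NW k"] by simp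
  finally show ?thesis .
qed

end
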